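(* Let $M,K\ge1$ be integers, let $P>0$, and for $k\in\mathcal K=\{1,\dots,K\}$ let $\beta_k>0$, $\sigma_k^2>0$ and let $\mathbf g_k\in\mathbb C^{M\times1}$ be the array response vectors described in the context. Consider the two optimization problems $\mathcal S^{\mathrm{ub}}$ (over precoding vectors $\mathbf w_1,\dots,\mathbf w_K\in\mathbb C^{M\times1}$) and $\mathcal M^{\mathrm{ub}}$ (over real scalars $\lambda_1,\dots,\lambda_K$) defined in the context. Denote by $\{\mathbf w_k^{\mathrm{opt}}\}_{k=1}^K$ and $\{\lambda_k^{\mathrm{opt}}\}_{k=1}^K$ the optimal solutions to $\mathcal S^{\mathrm{ub}}$ and $\mathcal M^{\mathrm{ub}}$, respectively. Then the precoding vectors $\{\mathbf w_k^{\mathrm{opt}}\}_{k=1}^K$ can be written as $$\mathbf w_k^{\mathrm{opt}}=\sqrt{q_k^{\mathrm{opt}}}\cdot\frac{(\mathbf V^{\mathrm{opt}})^{-1}\mathbf g_k}{\big\|(\mathbf V^{\mathrm{opt}})^{-1}\mathbf g_k\big\|},\qquad \forall k\in\mathcal K,$$ where the matrix $\mathbf V^{\mathrm{opt}}\in\mathbb C^{M\times M}$ and $q_k^{\mathrm{opt}}$ are given by $$\mathbf V^{\mathrm{opt}}=\sum_{k=1}^K\frac{\lambda_k^{\mathrm{opt}}\beta_k}{\sigma_k^2}\mathbf g_k\mathbf g_k^H+\mathbf I_M,\qquad q_k^{\mathrm{opt}}=\frac{\lambda_k^{\mathrm{opt}}\beta_k(\gamma_k^{\mathrm{opt}}+1)}{\mu^{\mathrm{opt}}\sigma_k^2}\big\|(\mathbf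 V^{\mathrm{opt}})^{-1}\mathbf g_k\big\|^2,$$ and the parameters $\gamma_k^{\mathrm{opt}}$ and $\mu^{\mathrm{opt}}$ are also determined by $\{\lambda_k^{\mathrm{opt}}\}_{k=1}^K$ as follows: $$\gamma_k^{\mathrm{opt}}=\frac1{1-(\lambda_k^{\mathrm{opt}}\beta_k/\sigma_k^2)\,\mathbf g_k^H(\mathbf V^{\mathrm{opt}})^{-1}\mathbf g_k}-1,$$ $$\mu^{\mathrm{opt}}=\frac1P\sum_{k=1}^K\frac{\lambda_k^{\mathrm{opt}}\beta_k(\gamma_k^{\mathrm{opt}}+1)}{\sigma_k^2}\big\|(\mathbf V^{\mathrm{opt}})^{-1}\mathbf g_k\big\|^2.$$
   Context: $(\cdot)^H$ is conjugate transpose, $\|\cdot\|$ the Euclidean norm, $\otimes$ the Kronecker product, $\mathbf I_M$ the $M\times M$ identity matrix, $j=\sqrt{-1}$. Array response vectors: for a positive integer $n$ and antenna spacing $d>0$, with carrier wavelength $\lambda_c>0$, put $\mathbf a_n(x)=\frac1{\sqrt n}\big(1,e^{-j\frac{2\pi d}{\lambda_c}x},\dots,e^{-j\frac{2\pi d}{\lambda_c}(n-1)x}\big)^T$ (the spacing $d$ may be different along each array axis). The transmitter has a uniform planar array with $M=M_{\mathrm x}M_{\mathrm y}$ elements, and for user $k$ with angles $(\theta_k^{\mathrm x},\theta_k^{\mathrm y})$, $\mathbf g_k=\mathbf a_{M_{\mathrm x}}(\sin\theta_k^{\mathrm y}\cos\theta_k^{\mathrm x})\otimes\mathbf a_{M_{\mathrm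 y}}(\cos\theta_k^{\mathrm y})$, which has unit norm. Here $\beta_k$ is the average channel power of user $k$, $\sigma_k^2$ its noise variance, and $P$ the total transmit power budget. Problem $\mathcal S^{\mathrm{ub}}$: $$\max_{\mathbf w_1,\dots,\mathbf w_K\in\mathbb C^{M\times 1}}\ \sum_{k=1}^K\log\left(1+\frac{|\mathbf w_k^H\mathbf g_k|^2\beta_k}{\sum_{i\ne k}|\mathbf w_i^H\mathbf g_k|^2\beta_k+\sigma_k^2}\right)\quad\text{s.t.}\quad\sum_{k=1}^K\|\mathbf w_k\|^2\le P.$$ Problem $\mathcal M^{\mathrm{ub}}$: $$\max_{\lambda_1,\dots,\lambda_K\in\mathbb R}\ \sum_{k=1}^K r_k(\lambda_1,\dots,\lambda_K)\quad\text{s.t.}\quad\sum_{k=1}^K\lambda_k=P,\ \ \lambda_k\ge0\ \ \forall k\in\mathcal K,$$ where $$r_k(\lambda_1,\dots,\lambda_K)=\log\det\Big(\sum_{i=1}^K\frac{\lambda_i\beta_i}{\sigma_i^2}\mathbf g_i\mathbf g_i^H+\mathbf I_M\Big)-\log\det\Big(\sum_{i\ne k}\frac{\lambda_i\beta_i}{\sigma_i^2}\mathbf g_i\mathbf g_i^H+\mathbf I_M\Big).$$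
   Formalization: Optimal solutions are not unique, so the claim is read as: for every optimal λ the formula gives an optimal solution of S^ub, and every optimal w equals the formula for some optimal λ up to a unit-modulus phase factor on each w_k. *)

theory Defs
  imports "HOL-Analysis.Analysis"
begin

definition cinner :: "complex^'n \<Rightarrow> complex^'n \<Rightarrow> complex" where
  "cinner u v = (\<Sum>i\<in>UNIV. cnj (u $ i) * v $ i)"

definition outer :: "complex^'n \<Rightarrow> complex^'n \<Rightarrow> complex^'n^'n" where
  "outer u v = (\<chi> i j. u $ i * cnj (v $ j))"

definition kron :: "complex^'a \<Rightarrow> complex^'b \<Rightarrow> complex^('a \<times> 'b)" where
  "kron u v = (\<chi> p. u $ fst p * v $ snd p)"

text \<open>The number of antennas along an axis is the cardinality of a linearly ordered finite
  index type. The position of an index (counted from 0) is the number of smaller indices, so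
  the exponents run through 0, ..., n - 1.\<close>

definition array_response :: "real \<Rightarrow> real \<Rightarrow> real \<Rightarrow> complex^'n::{finite,linorder}" where
  "array_response d lc x =
     (1 / sqrt (real CARD('n))) *\<^sub>R
       (\<chi> i. exp (- \<i> * complex_of_real (2 * pi * d / lc * real (card {j. j < i}) * x)))"

definition upa_response ::
  "real \<Rightarrow> real \<Rightarrow> real \<Rightarrow> real \<Rightarrow> real \<Rightarrow>
     complex^('mx::{finite,linorder} \<times> 'my::{finite,linorder})" where
  "upa_response dx dy lc \<theta>x \<theta>y =
     kron (array_response dx lc (sin \<theta>y * cos \<theta>x)) (array_response dy lc (cos \<theta>y))"

text \<open>Throughout, \<open>\<sigma> k ^ 2\<close> is the noise variance of user \<open>k\<close>.\<close>

definition sinr ::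
  "('k::finite \<Rightarrow> complex^'n) \<Rightarrow> ('k \<Rightarrow> real) \<Rightarrow> ('k \<Rightarrow> real) \<Rightarrow> ('k \<Rightarrow> complex^'n) \<Rightarrow> 'k \<Rightarrow> real" where
  "sinr g \<beta> \<sigma> w k =
     (cmod (cinner (w k) (g k)))\<^sup>2 * \<beta> k /
       ((\<Sum>i\<in>UNIV - {k}. (cmod (cinner (w i) (g k)))\<^sup>2 * \<beta> k) + (\<sigma> k)\<^sup>2)"

definition S_objective ::
  "('k::finite \<Rightarrow> complex^'n) \<Rightarrow> ('k \<Rightarrow> real) \<Rightarrow> ('k \<Rightarrow> real) \<Rightarrow> ('k \<Rightarrow> complex^'n) \<Rightarrow> real" where
  "S_objective g \<beta> \<sigma> w = (\<Sum>k\<in>UNIV. ln (1 + sinr g \<beta> \<sigma> w k))"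

definition S_feasible :: "real \<Rightarrow> ('k::finite \<Rightarrow> complex^'n) \<Rightarrow> bool" where
  "S_feasible P w \<longleftrightarrow> (\<Sum>k\<in>UNIV. (norm (w k))\<^sup>2) \<le> P"

definition S_optimal ::
  "('k::finite \<Rightarrow> complex^'n) \<Rightarrow> ('k \<Rightarrow> real) \<Rightarrow> ('k \<Rightarrow> real) \<Rightarrow> real \<Rightarrow> ('k \<Rightarrow> complex^'n) \<Rightarrow> bool" where
  "S_optimal g \<beta> \<sigma> P w \<longleftrightarrow> is_arg_max (S_objective g \<beta> \<sigma>) (S_feasible P) w"

definition cov_matrix ::
  "('k::finite \<Rightarrow> complex^'n) \<Rightarrow> ('k \<Rightarrow> real) \<Rightarrow> ('k \<Rightarrow> real) \<Rightarrow> 'k set \<Rightarrow> ('k \<Rightarrow> real) \<Rightarrow> complex^'n^'n" where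
  "cov_matrix g \<beta> \<sigma> A lam =
     (\<Sum>i\<in>A. (lam i * \<beta> i / (\<sigma> i)\<^sup>2) *\<^sub>R outer (g i) (g i)) + mat 1"

text \<open>For nonnegative \<open>lam\<close> the matrices are Hermitian and positive definite, so that their
  determinants, and the quadratic forms of their inverses used below, are real; \<open>Re\<close> only
  changes the type.\<close>

definition M_rate ::
  "('k::finite \<Rightarrow> complex^'n) \<Rightarrow> ('k \<Rightarrow> real) \<Rightarrow> ('k \<Rightarrow> real) \<Rightarrow> ('k \<Rightarrow> real) \<Rightarrow> 'k \<Rightarrow> real" where
  "M_rate g \<beta> \<sigma> lam k =
     ln (Re (det (cov_matrix g \<beta> \<sigma> UNIV lam))) - ln (Re (det (cov_matrix g \<beta> \<sigma> (UNIV - {k}) lam)))"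

definition M_objective ::
  "('k::finite \<Rightarrow> complex^'n) \<Rightarrow> ('k \<Rightarrow> real) \<Rightarrow> ('k \<Rightarrow> real) \<Rightarrow> ('k \<Rightarrow> real) \<Rightarrow> real" where
  "M_objective g \<beta> \<sigma> lam = (\<Sum>k\<in>UNIV. M_rate g \<beta> \<sigma> lam k)"

definition M_feasible :: "real \<Rightarrow> ('k::finite \<Rightarrow> real) \<Rightarrow> bool" where
  "M_feasible P lam \<longleftrightarrow> (\<Sum>k\<in>UNIV. lam k) = P \<and> (\<forall>k. lam k \<ge> 0)"

definition M_optimal ::
  "('k::finite \<Rightarrow> complex^'n) \<Rightarrow> ('k \<Rightarrow> real) \<Rightarrow> ('k \<Rightarrow> real) \<Rightarrow> real \<Rightarrow> ('k \<Rightarrow> real) \<Rightarrow> bool" where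
  "M_optimal g \<beta> \<sigma> P lam \<longleftrightarrow> is_arg_max (M_objective g \<beta> \<sigma>) (M_feasible P) lam"

definition V_mat ::
  "('k::finite \<Rightarrow> complex^'n) \<Rightarrow> ('k \<Rightarrow> real) \<Rightarrow> ('k \<Rightarrow> real) \<Rightarrow> ('k \<Rightarrow> real) \<Rightarrow> complex^'n^'n" where
  "V_mat g \<beta> \<sigma> lam = cov_matrix g \<beta> \<sigma> UNIV lam"

definition V_inv_g ::
  "('k::finite \<Rightarrow> complex^'n) \<Rightarrow> ('k \<Rightarrow> real) \<Rightarrow> ('k \<Rightarrow> real) \<Rightarrow> ('k \<Rightarrow> real) \<Rightarrow> 'k \<Rightarrow> complex^'n" where
  "V_inv_g g \<beta> \<sigma> lam k = matrix_inv (V_mat g \<beta> \<sigma> lam) *v g k"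

definition gamma_opt ::
  "('k::finite \<Rightarrow> complex^'n) \<Rightarrow> ('k \<Rightarrow> real) \<Rightarrow> ('k \<Rightarrow> real) \<Rightarrow> ('k \<Rightarrow> real) \<Rightarrow> 'k \<Rightarrow> real" where
  "gamma_opt g \<beta> \<sigma> lam k =
     1 / (1 - (lam k * \<beta> k / (\<sigma> k)\<^sup>2) * Re (cinner (g k) (V_inv_g g \<beta> \<sigma> lam k))) - 1"

definition mu_opt ::
  "('k::finite \<Rightarrow> complex^'n) \<Rightarrow> ('k \<Rightarrow> real) \<Rightarrow> ('k \<Rightarrow> real) \<Rightarrow> real \<Rightarrow> ('k \<Rightarrow> real) \<Rightarrow> real" where
  "mu_opt g \<beta> \<sigma> P lam =
     (1 / P) * (\<Sum>k\<in>UNIV. lam k * \<beta> k * (gamma_opt g \<beta> \<sigma> lam k + 1) / (\<sigma> k)\<^sup>2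
                            * (norm (V_inv_g g \<beta> \<sigma> lam k))\<^sup>2)"

definition q_opt ::
  "('k::finite \<Rightarrow> complex^'n) \<Rightarrow> ('k \<Rightarrow> real) \<Rightarrow> ('k \<Rightarrow> real) \<Rightarrow> real \<Rightarrow> ('k \<Rightarrow> real) \<Rightarrow> 'k \<Rightarrow> real" where
  "q_opt g \<beta> \<sigma> P lam k =
     lam k * \<beta> k * (gamma_opt g \<beta> \<sigma> lam k + 1) / (mu_opt g \<beta> \<sigma> P lam * (\<sigma> k)\<^sup>2)
       * (norm (V_inv_g g \<beta> \<sigma> lam k))\<^sup>2"

definition precoder ::
  "('k::finite \<Rightarrow> complex^'n) \<Rightarrow> ('k \<Rightarrow> real) \<Rightarrow> ('k \<Rightarrow> real) \<Rightarrow> real \<Rightarrow> ('k \<Rightarrow> real) \<Rightarrow> 'k \<Rightarrow> complex^'n" where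
  "precoder g \<beta> \<sigma> P lam k =
     sqrt (q_opt g \<beta> \<sigma> P lam k) *\<^sub>R (V_inv_g g \<beta> \<sigma> lam k /\<^sub>R norm (V_inv_g g \<beta> \<sigma> lam k))"

end

theory Submission
  imports Defs
begin

text \<open>Put \<open>b k = \<beta> k / (\<sigma> k)\<^sup>2\<close>, let \<open>V\<close> be the matrix belonging to \<open>lam\<close>, and let
  \<open>u k\<close> be \<open>V\<close> inverse applied to \<open>g k\<close>. By the matrix determinant lemma the rate of user \<open>k\<close>
  in the second problem is \<open>- ln (1 - lam k * b k * \<langle>g k, u k\<rangle>)\<close>. At an optimal \<open>lam\<close>, the
  first-order condition in the direction that rescales \<open>lam\<close> and adds weight to one user with
  \<open>lam k > 0\<close> says precisely that the precoders built from \<open>lam\<close> give user \<open>k\<close> the same rate in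
  the first problem. Conversely, the first-order condition at an optimal \<open>w\<close> makes \<open>w k\<close> a
  complex multiple of \<open>u k\<close> for a feasible \<open>lam\<close> with the same objective value. Both problems
  have optimal solutions by compactness, so their optimal values agree and each
  first-order correspondence maps optimal solutions to optimal solutions.\<close>

section \<open>Rank-one perturbations of determinants\<close>

text \<open>Subtracting \<open>x $ j\<close> times row \<open>k\<close> from row \<open>j\<close>
  restores \<open>axis j 1\<close>, so the determinant does not depend on \<open>S\<close>. For
  empty \<open>S\<close> it is Cramer's rule for the identity matrix.\<close>

lemma det_identity_row_replaced:
  fixes x y :: "'a::field^'n"
  assumes "finite S" "k \<notin> S"
  shows "det (\<chi> i. if i = k then y else if i \<in> S then axis i 1 + x $ i *s y else axis i 1) = y $ k"
  using assms
proof (induction S)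
  case empty
  have rows: "row i (mat 1 :: 'a^'n^'n) = axis i 1" for i
    by (simp add: row_def mat_def axis_def vec_eq_iff)
  have "(\<Sum>i\<in>UNIV. y $ i *s (axis i 1 :: 'a^'n)) = y"
    by (simp add: vec_eq_iff axis_def if_distrib[of "\<lambda>a. _ * a"] cong: if_cong)
  then show ?case
    using cramer_lemma_transpose[of k y "mat 1"] by (simp only: rows) (simp cong: if_cong)
next
  case (insert j S)
  then have "j \<noteq> k" by auto
  let ?A = "\<chi> i. if i = k then y else if i \<in> S then axis i 1 + x $ i *s y else axis i 1 :: 'a^'n^'n"
  have "(\<chi> i. if i = k then y else if i \<in> insert j S then axis i 1 + x $ i *s y else axis i 1)
      = (\<chi> i. if i = j then row j ?A + x $ j *s row k ?A else row i ?A)"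
    using insert.hyps \<open>j \<noteq> k\<close> by (auto simp: vec_eq_iff row_def)
  then have "det (\<chi> i. if i = k then y else if i \<in> insert j S then axis i 1 + x $ i *s y else axis i 1)
      = det ?A"
    using det_row_operation[OF \<open>j \<noteq> k\<close>, of ?A "x $ j"] by simp
  then show ?case using insert by simp
qed

text \<open>The perturbation is switched on row by row. Linearity in row \<open>k\<close> splits the
  determinant into the one without the perturbation of that row and \<open>x $ k\<close> times the
  determinant with row \<open>k\<close> replaced by \<open>y\<close>.\<close>

lemma det_identity_add_rows:
  fixes x y :: "'a::field^'n"
  assumes "finite S"
  shows "det (\<chi> i. if i \<in> S then axis i 1 + x $ i *s y else axis i 1) = 1 + (\<Sum>i\<in>S. x $ i * y $ i)"
  using assms
proof (induction S)
  case empty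
  have "(\<chi> i. axis i 1) = (mat 1 :: 'a^'n^'n)"
    by (simp add: mat_def axis_def vec_eq_iff)
  then show ?case by simp
next
  case (insert k S)
  let ?c = "\<lambda>i. if i \<in> S then axis i 1 + x $ i *s y else axis i 1 :: 'a^'n"
  have "(\<chi> i. if i \<in> insert k S then axis i 1 + x $ i *s y else axis i 1)
      = (\<chi> i. if i = k then axis k 1 + x $ k *s y else ?c i)"
    by (auto simp: vec_eq_iff)
  then have "det (\<chi> i. if i \<in> insert k S then axis i 1 + x $ i *s y else axis i 1)
      = det (\<chi> i. if i = k then axis k 1 else ?c i) + det (\<chi> i. if i = k then x $ k *s y else ?c i)"
    using det_row_add[of k "\<lambda>_. axis k 1" "\<lambda>_. x $ k *s y" ?c] by simp
  also have "(\<chi> i. if i = k then axis k 1 else ?c i) = (\<chi> i. ?c i)"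
    using insert.hyps by (auto simp: vec_eq_iff)
  also have "det (\<chi> i. if i = k then x $ k *s y else ?c i) = x $ k * y $ k"
    using det_row_mul[of k "x $ k" "\<lambda>_. y" ?c] det_identity_row_replaced[OF insert.hyps, of y x]
    by simp
  finally show ?case using insert by simp
qed

lemma det_identity_add_rank_one:
  fixes x y :: "'a::field^'n"
  shows "det (mat 1 + (\<chi> i j. x $ i * y $ j)) = 1 + (\<Sum>i\<in>UNIV. x $ i * y $ i)"
proof -
  have "mat 1 + (\<chi> i j. x $ i * y $ j) = (\<chi> i. if i \<in> UNIV then axis i 1 + x $ i *s y else axis i 1)"
    by (simp add: vec_eq_iff mat_def axis_def)
  then show ?thesis
    using det_identity_add_rows[of UNIV x y] by simp
qed

lemma matrix_inv_vector_cancel: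
  fixes A :: "'a::field^'n^'n"
  assumes "invertible A"
  shows "A *v (matrix_inv A *v x) = x"
proof -
  have "A ** matrix_inv A = mat 1"
    using assms unfolding invertible_def matrix_inv_def by (metis (mono_tags, lifting) someI_ex)
  then show ?thesis by (simp add: matrix_vector_mul_assoc)
qed

lemma scaleR_matrix_vector_mult:
  fixes A :: "complex^'n^'m"
  shows "(r *\<^sub>R A) *v x = r *\<^sub>R (A *v x)"
  by (simp add: vec_eq_iff matrix_vector_mult_def scaleR_sum_right)

lemma outer_vector_mult: "outer u v *v x = cinner v x *s u"
  by (simp add: vec_eq_iff outer_def cinner_def matrix_vector_mult_def sum_distrib_left
      sum_distrib_right mult_ac)

text \<open>The matrix determinant lemma: \<open>A\<close> factors out of the perturbed matrix and
  leaves the identity plus \<open>outer z x\<close>, where \<open>z\<close> is \<open>r\<close>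
  times \<open>A\<close> inverse applied to \<open>x\<close>.\<close>

lemma det_add_outer:
  fixes A :: "complex^'n^'n"
  assumes "invertible A"
  shows "det (A + r *\<^sub>R outer x x)
    = det A * (1 + of_real r * cinner x (matrix_inv A *v x))"
proof -
  define z where "z = of_real r *s (matrix_inv A *v x)"
  have z: "A *v z = of_real r *s x"
    by (simp add: z_def vector_scalar_commute matrix_inv_vector_cancel[OF assms])
  have "(A + r *\<^sub>R outer x x) *v v = A *v ((mat 1 + outer z x) *v v)" for v
    by (simp add: matrix_vector_mult_add_rdistrib matrix_vector_right_distrib outer_vector_mult
        vector_scalar_commute z scaleR_matrix_vector_mult vec_eq_iff
        scaleR_conv_of_real[where 'a = complex])
  then have "A + r *\<^sub>R outer x x = A ** (mat 1 + outer z x)"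
    by (simp add: matrix_eq matrix_vector_mul_assoc)
  moreover have "outer z x = (\<chi> i j. z $ i * (\<chi> j. cnj (x $ j)) $ j)"
    by (simp add: outer_def)
  ultimately show ?thesis
    using det_identity_add_rank_one[of z "\<chi> j. cnj (x $ j)"]
    by (simp add: det_mul cinner_def z_def sum_distrib_left mult_ac)
qed

lemma continuous_on_det:
  fixes f :: "'a::topological_space \<Rightarrow> 'b::real_normed_field^'n^'n"
  assumes "continuous_on S f"
  shows "continuous_on S (\<lambda>x. det (f x))"
  unfolding det_def using assms by (intro continuous_intros)

section \<open>Complex inner product and covariance matrices\<close>

lemma Re_cinner: "Re (cinner u v) = inner u v"
  by (simp add: cinner_def inner_vec_def inner_complex_def)

lemma cinner_self: "cinner u u = of_real ((norm u)\<^sup>2)"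
  by (simp add: cinner_def norm_vec_def L2_set_def sum_nonneg complex_norm_square mult.commute
      del: of_real_power)

lemma cnj_cinner: "cnj (cinner u v) = cinner v u"
  by (simp add: cinner_def mult.commute)

lemma cmod_cinner_commute: "cmod (cinner u v) = cmod (cinner v u)"
  by (metis cnj_cinner complex_mod_cnj)

lemma cinner_add: "cinner (u + v) x = cinner u x + cinner v x" "cinner x (u + v) = cinner x u + cinner x v"
  by (simp_all add: cinner_def algebra_simps sum.distrib)

lemma cinner_sum: "cinner x (\<Sum>i\<in>A. f i) = (\<Sum>i\<in>A. cinner x (f i))"
  by (simp add: cinner_def sum_distrib_left sum.swap[of _ A])

lemma cinner_scale: "cinner x (c *s u) = c * cinner x u" "cinner (c *s u) x = cnj c * cinner u x"
  by (simp_all add: cinner_def algebra_simps sum_distrib_left)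

lemma cinner_scaleR: "cinner x (r *\<^sub>R u) = of_real r * cinner x u" "cinner (r *\<^sub>R u) x = of_real r * cinner u x"
  by (simp_all add: cinner_def algebra_simps sum_distrib_left scaleR_conv_of_real[where 'a = complex])

lemma cinner_zero [simp]: "cinner 0 x = 0" "cinner x 0 = 0"
  by (simp_all add: cinner_def)

text \<open>The two problems for arbitrary nonzero channel vectors; the array responses are an
  instance.\<close>

locale dual_channels =
  fixes g :: "'k::finite \<Rightarrow> complex^'n"
    and \<beta> \<sigma> :: "'k \<Rightarrow> real"
    and P :: real
  assumes P_pos: "P > 0"
    and \<beta>_pos: "\<And>k. \<beta> k > 0"
    and \<sigma>_pos: "\<And>k. (\<sigma> k)\<^sup>2 > 0"
    and g_nonzero: "\<And>k. g k \<noteq> 0"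
begin

definition snr :: "'k \<Rightarrow> real" where "snr k = \<beta> k / (\<sigma> k)\<^sup>2"
abbreviation "cov A lam \<equiv> cov_matrix g \<beta> \<sigma> A lam"
abbreviation "mmse lam k \<equiv> V_inv_g g \<beta> \<sigma> lam k"
text \<open>The quadratic form of the inverse covariance matrix at \<open>g k\<close>. The real
  inner product keeps it real-valued; for nonnegative weights \<open>cinner_mmse\<close> shows that
  the complex form has the same value.\<close>

abbreviation "gain lam k \<equiv> inner (g k) (mmse lam k)"

lemma snr_pos: "snr k > 0"
  using \<beta>_pos \<sigma>_pos by (simp add: snr_def)

lemma cov_insert:
  "k \<notin> A \<Longrightarrow> cov (insert k A) lam = cov A lam + (lam k * snr k) *\<^sub>R outer (g k) (g k)"
  by (simp add: cov_matrix_def snr_def algebra_simps)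

lemma cov_vector_mult:
  "cov A lam *v x = (\<Sum>i\<in>A. (lam i * snr i) *\<^sub>R (cinner (g i) x *s g i)) + x"
proof (induction A rule: infinite_finite_induct)
  case (insert k A)
  then show ?case
    by (simp add: cov_insert matrix_vector_mult_add_rdistrib scaleR_matrix_vector_mult
        outer_vector_mult algebra_simps)
qed (simp_all add: cov_matrix_def)

text \<open>The weights are real, so conjugation only exchanges the two arguments in the expanded
  form.\<close>

lemma cov_self_adjoint: "cinner x (cov A lam *v y) = cinner (cov A lam *v x) y"
proof -
  have "cinner x (cov A lam *v y)
      = (\<Sum>i\<in>A. of_real (lam i * snr i) * (cinner x (g i) * cinner (g i) y)) + cinner x y" for x y
    by (simp add: cov_vector_mult cinner_add cinner_sum cinner_scaleR cinner_scale mult_ac)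
  note expand = this
  have "cinner (cov A lam *v x) y = cnj (cinner y (cov A lam *v x))"
    by (simp only: cnj_cinner)
  also have "\<dots> = cinner x (cov A lam *v y)"
    unfolding expand by (simp add: cnj_cinner mult_ac)
  finally show ?thesis by simp
qed

lemma inner_cov_self_adjoint: "inner x (cov A lam *v y) = inner (cov A lam *v x) y"
  using arg_cong[OF cov_self_adjoint, of Re] by (simp add: Re_cinner)

lemma cov_quadratic_form:
  "cinner x (cov A lam *v x)
    = of_real ((\<Sum>i\<in>A. lam i * snr i * (cmod (cinner (g i) x))\<^sup>2) + (norm x)\<^sup>2)"
proof -
  have "cinner x (g i) * cinner (g i) x = of_real ((cmod (cinner (g i) x))\<^sup>2)" for i
    by (metis cnj_cinner complex_norm_square mult.commute)
  then show ?thesis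
    by (simp add: cov_vector_mult cinner_add cinner_sum cinner_scaleR cinner_scale cinner_self
        mult_ac)
qed

lemma inner_cov:
  "inner x (cov A lam *v x) = (\<Sum>i\<in>A. lam i * snr i * (cmod (cinner (g i) x))\<^sup>2) + (norm x)\<^sup>2"
  using arg_cong[OF cov_quadratic_form, of Re] by (simp add: Re_cinner)

section \<open>Positive definiteness for nonnegative weights\<close>

context
  fixes lam :: "'k \<Rightarrow> real"
  assumes lam_nonneg: "\<forall>k. lam k \<ge> 0"
begin

lemma snr_weight_nonneg: "lam i * snr i \<ge> 0"
  using lam_nonneg snr_pos less_imp_le mult_nonneg_nonneg by blast

text \<open>The identity summand contributes the squared norm and every rank-one summand a
  nonnegative term.\<close>

lemma cov_definite: "(norm x)\<^sup>2 \<le> inner x (cov A lam *v x)"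
  unfolding inner_cov using snr_weight_nonneg by (simp add: sum_nonneg)

lemma cov_invertible: "invertible (cov A lam)"
proof -
  have "x = 0" if "cov A lam *v x = 0" for x
    using cov_definite[of x A] that by simp
  then show ?thesis
    using matrix_left_invertible_ker invertible_left_inverse by blast
qed

text \<open>Users are added one at a time. Each rank-one update multiplies the determinant by one
  plus a nonnegative real number.\<close>

lemma det_cov_pos: "\<exists>r>0. det (cov A lam) = of_real r"
proof (induction A rule: infinite_finite_induct)
  case (insert k A)
  then obtain r where r: "r > 0" "det (cov A lam) = of_real r" by blast
  define u where "u = matrix_inv (cov A lam) *v g k"
  \<comment> \<open>Replacing \<open>g k\<close> by \<open>cov A lam *v u\<close> turns this into a
    quadratic form of the covariance matrix, which is real and nonnegative.\<close>
  have "cinner (g k) u = cinner u (cov A lam *v u)"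
    using matrix_inv_vector_cancel[OF cov_invertible] cov_self_adjoint[where x = u and A = A and lam = lam and y = u]
    by (simp add: u_def)
  moreover have "0 \<le> (\<Sum>i\<in>A. lam i * snr i * (cmod (cinner (g i) u))\<^sup>2) + (norm u)\<^sup>2"
    using snr_weight_nonneg by (simp add: sum_nonneg)
  ultimately obtain q where q: "q \<ge> 0" "cinner (g k) u = of_real q"
    unfolding cov_quadratic_form by blast
  have "det (cov (insert k A) lam) = of_real (r * (1 + lam k * snr k * q))"
    using insert.hyps r(2) q(2) det_add_outer[OF cov_invertible, of A "lam k * snr k" "g k"]
    by (simp add: cov_insert u_def)
  moreover have "r * (1 + lam k * snr k * q) > 0"
    using r(1) q(1) snr_weight_nonneg[of k] by (intro mult_pos_pos add_pos_nonneg) auto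
  ultimately show ?case by blast
qed (auto simp: cov_matrix_def intro: exI[of _ 1])

lemma cov_mmse: "cov UNIV lam *v mmse lam k = g k"
  by (simp add: V_inv_g_def V_mat_def matrix_inv_vector_cancel[OF cov_invertible])

lemma mmse_nonzero: "mmse lam k \<noteq> 0"
  using cov_mmse[of k] g_nonzero[of k] by auto

lemma cinner_mmse: "cinner (g k) (mmse lam k) = of_real (gain lam k)"
proof -
  have "cinner (g k) (mmse lam k) = cinner (mmse lam k) (cov UNIV lam *v mmse lam k)"
    using cov_self_adjoint[where x = "mmse lam k" and A = UNIV and lam = lam and y = "mmse lam k"] by (simp add: cov_mmse)
  then obtain q where "cinner (g k) (mmse lam k) = of_real q"
    unfolding cov_quadratic_form by blast
  then show ?thesis
    by (simp add: Re_cinner[symmetric])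
qed

lemma gain_eq:
  "gain lam k = (\<Sum>i\<in>UNIV. lam i * snr i * (cmod (cinner (g i) (mmse lam k)))\<^sup>2) + (norm (mmse lam k))\<^sup>2"
  using inner_cov[of "mmse lam k" UNIV lam] by (simp add: cov_mmse inner_commute)

lemma gain_pos: "gain lam k > 0"
proof -
  have "0 < (norm (mmse lam k))\<^sup>2"
    using mmse_nonzero by simp
  also have "\<dots> \<le> gain lam k"
    using cov_definite[of "mmse lam k" UNIV] by (simp add: cov_mmse inner_commute)
  finally show ?thesis .
qed

text \<open>The gain is the maximum over \<open>u\<close> of the left-hand side, attained at
  \<open>mmse lam k\<close>; the deficit is the quadratic form at \<open>u - mmse lam k\<close>. For
  fixed \<open>u\<close> the bound is affine in the weights.\<close>

lemma gain_lower_bound: "2 * inner u (g k) - inner u (cov UNIV lam *v u) \<le> gain lam k"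
proof -
  let ?y = "mmse lam k"
  have "0 \<le> inner (u - ?y) (cov UNIV lam *v (u - ?y))"
    using cov_definite[of "u - ?y" UNIV] zero_le_power2[of "norm (u - ?y)"] by linarith
  also have "\<dots> = inner u (cov UNIV lam *v u) - inner u (g k) - inner ?y (cov UNIV lam *v u)
      + inner ?y (g k)"
    by (simp add: matrix_vector_mult_diff_distrib cov_mmse inner_diff_left inner_diff_right)
  also have "inner ?y (cov UNIV lam *v u) = inner u (g k)"
    by (simp add: inner_cov_self_adjoint cov_mmse inner_commute)
  finally show ?thesis by (simp add: inner_commute)
qed

text \<open>Removing user \<open>k\<close> is a rank-one update with negative weight, so the
  quotient of the two determinants is \<open>1 - lam k * snr k * gain lam k\<close>. Positivity of
  both determinants makes this factor positive.\<close>

lemma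
  shows M_rate_eq: "M_rate g \<beta> \<sigma> lam k = - ln (1 - lam k * snr k * gain lam k)" (is ?rate)
    and gain_bound: "1 - lam k * snr k * gain lam k > 0" (is ?pos)
proof -
  obtain r where r: "r > 0" "det (cov UNIV lam) = of_real r"
    using det_cov_pos by blast
  obtain r' where r': "r' > 0" "det (cov (UNIV - {k}) lam) = of_real r'"
    using det_cov_pos by blast
  have "cov UNIV lam = cov (insert k (UNIV - {k})) lam"
    by (simp add: insert_absorb)
  also have "\<dots> = cov (UNIV - {k}) lam + (lam k * snr k) *\<^sub>R outer (g k) (g k)"
    by (rule cov_insert) simp
  finally have "cov (UNIV - {k}) lam = cov UNIV lam + (- (lam k * snr k)) *\<^sub>R outer (g k) (g k)"
    by simp
  then have "complex_of_real r' = of_real r * (1 + of_real (- (lam k * snr k)) * cinner (g k) (mmse lam k))"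
    using det_add_outer[OF cov_invertible, of UNIV "- (lam k * snr k)" "g k"] r r'
    by (simp add: V_inv_g_def V_mat_def)
  also have "\<dots> = of_real (r * (1 - lam k * snr k * gain lam k))"
    by (simp add: cinner_mmse)
  finally have eq: "r' = r * (1 - lam k * snr k * gain lam k)"
    using of_real_eq_iff by blast
  with r(1) r'(1) show pos: ?pos by (metis zero_less_mult_pos)
  have "ln r' = ln r + ln (1 - lam k * snr k * gain lam k)"
    unfolding eq using r(1) pos by (simp add: ln_mult_pos)
  then show ?rate
    using r(2) r'(2) by (simp add: M_rate_def)
qed

end

section \<open>The dual problem\<close>

text \<open>This is \<open>gamma_opt\<close> plus one. For nonnegative weights its logarithm is the
  rate of user \<open>k\<close> in the second problem, and at an optimum it is one plus the
  signal-to-interference-plus-noise ratio of the precoders.\<close>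

definition boost :: "('k \<Rightarrow> real) \<Rightarrow> 'k \<Rightarrow> real" where
  "boost lam k = 1 / (1 - lam k * snr k * gain lam k)"

lemma gamma_opt_eq: "gamma_opt g \<beta> \<sigma> lam k + 1 = boost lam k"
  by (simp add: gamma_opt_def boost_def snr_def Re_cinner)

lemma mu_opt_eq:
  "mu_opt g \<beta> \<sigma> P lam = (1 / P) * (\<Sum>k\<in>UNIV. boost lam k * (lam k * snr k * (norm (mmse lam k))\<^sup>2))"
  unfolding mu_opt_def gamma_opt_eq by (simp add: snr_def mult_ac)

lemma boost_pos:
  assumes "\<forall>k. lam k \<ge> 0"
  shows "boost lam k > 0"
  using gain_bound[OF assms] by (simp add: boost_def)

lemma M_rate_boost:
  assumes "\<forall>k. lam k \<ge> 0"
  shows "M_rate g \<beta> \<sigma> lam k = ln (boost lam k)"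
  using gain_bound[OF assms, of k] by (simp add: boost_def M_rate_eq[OF assms] ln_div)

lemma mu_opt_pos:
  assumes "M_feasible P lam"
  shows "mu_opt g \<beta> \<sigma> P lam > 0"
proof -
  have nonneg: "\<forall>k. lam k \<ge> 0" and total: "sum lam UNIV = P"
    using assms by (auto simp: M_feasible_def)
  have "\<exists>k. lam k \<noteq> 0"
  proof (rule ccontr)
    assume "\<not> ?thesis"
    then show False using total P_pos by simp
  qed
  then obtain k where "lam k > 0"
    using nonneg by (metis less_eq_real_def)
  then have "0 < boost lam k * (lam k * snr k * (norm (mmse lam k))\<^sup>2)"
    using boost_pos[OF nonneg] snr_pos mmse_nonzero[OF nonneg] by simp
  moreover have "0 \<le> boost lam k * (lam k * snr k * (norm (mmse lam k))\<^sup>2)" for k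
    using boost_pos[OF nonneg, of k] snr_weight_nonneg[OF nonneg, of k] by simp
  ultimately have "0 < (\<Sum>k\<in>UNIV. boost lam k * (lam k * snr k * (norm (mmse lam k))\<^sup>2))"
    by (intro sum_pos2[of _ k]) auto
  then show ?thesis
    unfolding mu_opt_eq using P_pos by simp
qed

text \<open>The objective is minorised by freezing the vectors \<open>mmse lam k\<close> in the variational
  characterisation of the gain. The minorant agrees with the objective at \<open>lam\<close>, so it is
  stationary there too, and no derivative of an inverse or a determinant is needed.\<close>

lemma M_objective_minorant:
  assumes lam: "\<forall>k. lam k \<ge> 0" and lam': "\<forall>k. lam' k \<ge> 0"
  shows "(\<Sum>k\<in>UNIV. - ln (1 - lam' k * snr k *
      (gain lam k - (\<Sum>j\<in>UNIV. (lam' j - lam j) * snr j * (cmod (cinner (g j) (mmse lam k)))\<^sup>2))))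
    \<le> M_objective g \<beta> \<sigma> lam'"
  unfolding M_objective_def
proof (rule sum_mono)
  fix k
  let ?u = "mmse lam k"
  let ?a = "gain lam k - (\<Sum>j\<in>UNIV. (lam' j - lam j) * snr j * (cmod (cinner (g j) ?u))\<^sup>2)"
  \<comment> \<open>\<open>?a\<close> is the variational lower bound for the gain at
    \<open>lam'\<close>, tested with the vector belonging to \<open>lam\<close>.\<close>
  have "?a = 2 * inner ?u (g k) - inner ?u (cov UNIV lam' *v ?u)"
    unfolding inner_cov inner_commute[of ?u] gain_eq[OF lam]
    by (simp add: left_diff_distrib sum_subtractf)
  then have "?a \<le> gain lam' k"
    using gain_lower_bound[OF lam', of ?u k] by simp
  then have "lam' k * snr k * ?a \<le> lam' k * snr k * gain lam' k"
    using snr_weight_nonneg[OF lam'] by (rule mult_left_mono)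
  then show "- ln (1 - lam' k * snr k * ?a) \<le> M_rate g \<beta> \<sigma> lam' k"
    using gain_bound[OF lam', of k] by (simp add: M_rate_eq[OF lam'])
qed

text \<open>The minorant touches the objective at \<open>lam\<close>, so along a feasible segment
  through \<open>lam\<close> it has a local maximum there. Setting its derivative to zero gives the
  identity.\<close>

lemma M_stationary:
  assumes opt: "M_optimal g \<beta> \<sigma> P lam" and i: "lam i > 0"
  shows "boost lam i * snr i * gain lam i
    - (\<Sum>k\<in>UNIV. boost lam k * lam k * snr k * (snr i * (cmod (cinner (g i) (mmse lam k)))\<^sup>2))
    = mu_opt g \<beta> \<sigma> P lam"
proof -
  have feas: "M_feasible P lam" and max: "\<And>l. M_feasible P l \<Longrightarrow> M_objective g \<beta> \<sigma> l \<le> M_objective g \<beta> \<sigma> lam"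
    using opt by (auto simp: M_optimal_def is_arg_max_linorder)
  have nonneg: "\<forall>k. lam k \<ge> 0" and total: "sum lam UNIV = P"
    using feas by (auto simp: M_feasible_def)
  have le_P: "lam i \<le> P"
    unfolding total[symmetric] by (rule member_le_sum) (auto simp: nonneg)
  \<comment> \<open>Moving by \<open>s\<close> gives \<open>(1 - s / P)\<close> times
    \<open>lam\<close> plus weight \<open>s\<close> on user \<open>i\<close>, which preserves the
    total \<open>P\<close>.\<close>
  define d where "d j = (if j = i then 1 else 0) - lam j / P" for j
  have d_sum: "sum d UNIV = 0"
    using total P_pos by (simp add: d_def sum_subtractf sum_divide_distrib[symmetric])
  define R where "R k = (\<Sum>j\<in>UNIV. d j * snr j * (cmod (cinner (g j) (mmse lam k)))\<^sup>2)" for k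
  define F where "F s = (\<Sum>k\<in>UNIV. - ln (1 - (lam k + s * d k) * snr k * (gain lam k - s * R k)))" for s
  have "(F has_real_derivative
      (\<Sum>k\<in>UNIV. boost lam k * (d k * snr k * gain lam k - lam k * snr k * R k))) (at 0)"
    unfolding F_def using gain_bound[OF nonneg]
    by (auto intro!: derivative_eq_intros sum.cong simp: boost_def divide_simps)
  \<comment> \<open>Both signs of \<open>s\<close> are admissible: since \<open>lam i\<close> is
    positive and at most \<open>P\<close>, all weights stay nonnegative for \<open>s\<close> of
    modulus below \<open>lam i\<close>.\<close>
  moreover have "F s \<le> F 0" if "\<bar>0 - s\<bar> < lam i" for s
  proof -
    define l where "l j = lam j + s * d j" for j
    have "0 \<le> 1 - s / P"
      using that le_P P_pos by (auto simp: field_simps)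
    then have "0 \<le> lam j * (1 - s / P)" for j
      using nonneg by simp
    moreover have "0 \<le> lam i + s * (1 - lam i / P)"
    proof -
      have "\<bar>s * (1 - lam i / P)\<bar> \<le> \<bar>s\<bar> * 1"
        unfolding abs_mult using le_P P_pos i by (intro mult_left_mono) (auto simp: field_simps)
      then show ?thesis using that by linarith
    qed
    ultimately have "l j \<ge> 0" for j
      by (cases "j = i") (simp_all add: l_def d_def algebra_simps)
    then have l_nonneg: "\<forall>j. l j \<ge> 0" by blast
    have "M_feasible P l"
      using l_nonneg total d_sum
      by (simp add: M_feasible_def l_def sum.distrib sum_distrib_left[symmetric])
    then have le: "M_objective g \<beta> \<sigma> l \<le> M_objective g \<beta> \<sigma> lam"
      by (rule max)
    have diff: "l j - lam j = s * d j" for j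
      by (simp add: l_def)
    have "F s \<le> M_objective g \<beta> \<sigma> l"
      using M_objective_minorant[OF nonneg l_nonneg] diff
      by (simp add: F_def R_def sum_distrib_left mult.assoc flip: l_def)
    also note le
    also have "M_objective g \<beta> \<sigma> lam = F 0"
      by (simp add: F_def M_objective_def M_rate_eq[OF nonneg])
    finally show ?thesis .
  qed
  ultimately have "(\<Sum>k\<in>UNIV. boost lam k * (d k * snr k * gain lam k - lam k * snr k * R k)) = 0"
    using DERIV_local_max[of F _ 0 "lam i"] i by blast
  moreover have "R k = snr i * (cmod (cinner (g i) (mmse lam k)))\<^sup>2
      - (gain lam k - (norm (mmse lam k))\<^sup>2) / P" for k
  proof -
    have "R k = (\<Sum>j\<in>UNIV. (if j = i then snr i * (cmod (cinner (g i) (mmse lam k)))\<^sup>2 else 0)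
        - lam j * snr j * (cmod (cinner (g j) (mmse lam k)))\<^sup>2 / P)"
      unfolding R_def d_def by (rule sum.cong) (simp_all add: left_diff_distrib)
    then show ?thesis
      unfolding gain_eq[OF nonneg] by (simp add: sum_subtractf sum_divide_distrib)
  qed
  \<comment> \<open>The two terms with \<open>gain lam k / P\<close>, one from \<open>d k\<close>
    and one from \<open>R k\<close>, cancel. What remains of the rescaling sums to
    \<open>mu_opt\<close>.\<close>
  moreover have "boost lam k * (d k * snr k * gain lam k - lam k * snr k * (X - (gain lam k - Y) / P))
      = (if k = i then boost lam i * snr i * gain lam i else 0) - boost lam k * lam k * snr k * X
        - (1 / P) * (boost lam k * (lam k * snr k * Y))" for k X Y
    using P_pos by (simp add: d_def field_simps)
  ultimately show ?thesis
    unfolding mu_opt_eq by (simp add: sum_subtractf sum_divide_distrib)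
qed

section \<open>Precoders built from dual weights\<close>

lemma precoder_eq:
  assumes "M_feasible P lam"
  shows "precoder g \<beta> \<sigma> P lam k
    = sqrt (lam k * snr k * boost lam k / mu_opt g \<beta> \<sigma> P lam) *\<^sub>R mmse lam k"
proof -
  \<comment> \<open>The squared norm in \<open>q_opt\<close> compensates the normalisation of the
    direction in \<open>precoder\<close>.\<close>
  have "q_opt g \<beta> \<sigma> P lam k
      = lam k * snr k * boost lam k / mu_opt g \<beta> \<sigma> P lam * (norm (mmse lam k))\<^sup>2"
    unfolding q_opt_def gamma_opt_eq by (simp add: snr_def)
  moreover have "mmse lam k \<noteq> 0"
    using assms mmse_nonzero by (simp add: M_feasible_def)
  ultimately show ?thesis
    by (simp add: precoder_def real_sqrt_mult real_sqrt_divide)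
qed

lemma precoder_coefficient_nonneg:
  assumes "M_feasible P lam"
  shows "lam k * snr k * boost lam k / mu_opt g \<beta> \<sigma> P lam \<ge> 0"
proof -
  have nonneg: "\<forall>k. lam k \<ge> 0"
    using assms by (simp add: M_feasible_def)
  show ?thesis
    using snr_weight_nonneg[OF nonneg, of k] boost_pos[OF nonneg, of k] mu_opt_pos[OF assms] by simp
qed

text \<open>\<open>mu_opt\<close> is the normalisation for which the squared norms sum to exactly
  \<open>P\<close>.\<close>

lemma precoder_feasible:
  assumes "M_feasible P lam"
  shows "S_feasible P (precoder g \<beta> \<sigma> P lam)"
proof -
  let ?\<mu> = "mu_opt g \<beta> \<sigma> P lam"
  have "(norm (precoder g \<beta> \<sigma> P lam k))\<^sup>2
      = (boost lam k * (lam k * snr k * (norm (mmse lam k))\<^sup>2)) / ?\<mu>" for k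
    using precoder_coefficient_nonneg[OF assms, of k]
    by (simp add: precoder_eq[OF assms] power_mult_distrib mult_ac)
  then have "(\<Sum>k\<in>UNIV. (norm (precoder g \<beta> \<sigma> P lam k))\<^sup>2)
      = (\<Sum>k\<in>UNIV. boost lam k * (lam k * snr k * (norm (mmse lam k))\<^sup>2)) / ?\<mu>"
    by (simp add: sum_divide_distrib)
  also have "(\<Sum>k\<in>UNIV. boost lam k * (lam k * snr k * (norm (mmse lam k))\<^sup>2)) = P * ?\<mu>"
    using P_pos by (simp add: mu_opt_eq)
  finally have "(\<Sum>k\<in>UNIV. (norm (precoder g \<beta> \<sigma> P lam k))\<^sup>2) = P * ?\<mu> / ?\<mu>" .
  then show ?thesis
    using mu_opt_pos[OF assms] by (simp add: S_feasible_def)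
qed

text \<open>Dividing by the noise variance makes the noise equal to one; adding one to the ratio
  then adds the interference and the noise to the numerator.\<close>

lemma sinr_eq:
  "1 + sinr g \<beta> \<sigma> w k = ((\<Sum>i\<in>UNIV. snr k * (cmod (cinner (w i) (g k)))\<^sup>2) + 1)
    / ((\<Sum>i\<in>UNIV - {k}. snr k * (cmod (cinner (w i) (g k)))\<^sup>2) + 1)"
proof -
  let ?I = "\<Sum>i\<in>UNIV - {k}. snr k * (cmod (cinner (w i) (g k)))\<^sup>2"
  have I: "(\<Sum>i\<in>UNIV - {k}. (cmod (cinner (w i) (g k)))\<^sup>2 * \<beta> k) + (\<sigma> k)\<^sup>2 = (\<sigma> k)\<^sup>2 * (?I + 1)"
    using \<sigma>_pos[of k] by (simp add: sum_distrib_left snr_def field_simps)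
  have "?I \<ge> 0"
    using snr_pos[of k] by (simp add: sum_nonneg)
  moreover have "sinr g \<beta> \<sigma> w k = snr k * (cmod (cinner (w k) (g k)))\<^sup>2 / (?I + 1)"
    unfolding sinr_def I snr_def using \<sigma>_pos[of k] by (simp add: mult.commute)
  moreover have "(\<Sum>i\<in>UNIV. snr k * (cmod (cinner (w i) (g k)))\<^sup>2)
      = snr k * (cmod (cinner (w k) (g k)))\<^sup>2 + ?I"
    by (rule sum.remove) auto
  ultimately show ?thesis
    by (simp add: field_simps)
qed

text \<open>A user of weight zero has zero precoder and both sides are one. Otherwise stationarity
  gives the total received power plus noise as \<open>boost lam k\<close> times a quantity that
  turns out to be the interference plus noise.\<close>

lemma sinr_precoder:
  assumes opt: "M_optimal g \<beta> \<sigma> P lam"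
  shows "1 + sinr g \<beta> \<sigma> (precoder g \<beta> \<sigma> P lam) k = boost lam k"
proof -
  let ?\<mu> = "mu_opt g \<beta> \<sigma> P lam"
  have feas: "M_feasible P lam"
    using opt by (simp add: M_optimal_def is_arg_max_linorder)
  then have nonneg: "\<forall>k. lam k \<ge> 0"
    by (simp add: M_feasible_def)
  show ?thesis
  proof (cases "lam k = 0")
    case True
    then show ?thesis
      by (simp add: sinr_def precoder_eq[OF feas] boost_def)
  next
    case False
    then have k: "lam k > 0" using nonneg by (simp add: less_le)
    define S where "S i = snr k * (cmod (cinner (precoder g \<beta> \<sigma> P lam i) (g k)))\<^sup>2" for i
    have S_eq: "S i = boost lam i * lam i * snr i * (snr k * (cmod (cinner (g k) (mmse lam i)))\<^sup>2) / ?\<mu>" for i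
      using precoder_coefficient_nonneg[OF feas, of i]
      by (simp add: S_def precoder_eq[OF feas] cinner_scaleR norm_mult power_mult_distrib
          cmod_cinner_commute[of "mmse lam i"])
    have total: "(\<Sum>i\<in>UNIV. S i) + 1 = boost lam k * (snr k * gain lam k / ?\<mu>)"
      using M_stationary[OF opt k] mu_opt_pos[OF feas]
      by (simp add: S_eq sum_divide_distrib[symmetric] field_simps)
    \<comment> \<open>The user's own signal is the fraction
      \<open>lam k * snr k * gain lam k\<close> of the total, so the remaining fraction is the
      reciprocal of \<open>boost lam k\<close>.\<close>
    have "S k = boost lam k * (snr k * gain lam k / ?\<mu>) * (lam k * snr k * gain lam k)"
      unfolding S_eq cinner_mmse[OF nonneg] by (simp add: power2_eq_square)
    moreover have "(\<Sum>i\<in>UNIV. S i) = S k + (\<Sum>i\<in>UNIV - {k}. S i)"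
      by (rule sum.remove) auto
    ultimately have "(\<Sum>i\<in>UNIV - {k}. S i) + 1
        = boost lam k * (1 - lam k * snr k * gain lam k) * (snr k * gain lam k / ?\<mu>)"
      using total by (simp add: algebra_simps)
    also have "boost lam k * (1 - lam k * snr k * gain lam k) = 1"
      using gain_bound[OF nonneg, of k] by (simp add: boost_def)
    finally have interference: "(\<Sum>i\<in>UNIV - {k}. S i) + 1 = snr k * gain lam k / ?\<mu>" by simp
    have "snr k * gain lam k / ?\<mu> > 0"
      using snr_pos gain_pos[OF nonneg] mu_opt_pos[OF feas] by simp
    then show ?thesis
      unfolding sinr_eq S_def[symmetric] total interference
      by (intro nonzero_mult_div_cancel_right) auto
  qed
qed

lemma S_objective_precoder:
  assumes "M_optimal g \<beta> \<sigma> P lam"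
  shows "S_objective g \<beta> \<sigma> (precoder g \<beta> \<sigma> P lam) = M_objective g \<beta> \<sigma> lam"
proof -
  have "\<forall>k. lam k \<ge> 0"
    using assms by (simp add: M_optimal_def is_arg_max_linorder M_feasible_def)
  then show ?thesis
    by (simp add: S_objective_def M_objective_def sinr_precoder[OF assms] M_rate_boost)
qed

section \<open>The precoding problem\<close>

definition load :: "('k \<Rightarrow> complex^'n) \<Rightarrow> real" where
  "load w = (\<Sum>i\<in>UNIV. (norm (w i))\<^sup>2) / P"

text \<open>Power arriving at user \<open>k\<close> from the streams in \<open>A\<close>, in units
  of the noise variance of user \<open>k\<close>.\<close>

definition received :: "('k \<Rightarrow> complex^'n) \<Rightarrow> 'k set \<Rightarrow> 'k \<Rightarrow> real" where
  "received w A k = (\<Sum>i\<in>A. snr k * (cmod (cinner (w i) (g k)))\<^sup>2)"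

text \<open>Measuring the noise in units of the transmit power makes the objective invariant under
  scaling, so the power constraint disappears and an optimum is a free stationary point.\<close>

definition scaled_objective :: "('k \<Rightarrow> complex^'n) \<Rightarrow> real" where
  "scaled_objective w
    = (\<Sum>k\<in>UNIV. ln (received w UNIV k + load w) - ln (received w (UNIV - {k}) k + load w))"

lemma load_nonneg: "load w \<ge> 0"
  using P_pos by (simp add: load_def sum_nonneg)

lemma received_nonneg: "received w A k \<ge> 0"
  using snr_pos[of k] by (simp add: received_def sum_nonneg)

lemma S_feasible_iff: "S_feasible P w \<longleftrightarrow> load w \<le> 1"
  using P_pos by (simp add: S_feasible_def load_def)

lemma received_split:
  "received w UNIV k = snr k * (cmod (cinner (w k) (g k)))\<^sup>2 + received w (UNIV - {k}) k"
  unfolding received_def by (rule sum.remove) auto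

lemma S_objective_eq:
  "S_objective g \<beta> \<sigma> w
    = (\<Sum>k\<in>UNIV. ln (received w UNIV k + 1) - ln (received w (UNIV - {k}) k + 1))"
  unfolding S_objective_def sinr_eq received_def[symmetric]
proof (rule sum.cong)
  fix k
  have "received w A k + 1 > 0" for A
    using received_nonneg[of w A k] by simp
  then show "ln ((received w UNIV k + 1) / (received w (UNIV - {k}) k + 1))
      = ln (received w UNIV k + 1) - ln (received w (UNIV - {k}) k + 1)"
    by (simp only: ln_divide_pos)
qed simp

lemma scaled_objective_unit_load: "load w = 1 \<Longrightarrow> scaled_objective w = S_objective g \<beta> \<sigma> w"
  by (simp add: scaled_objective_def S_objective_eq)

lemma load_scaleR: "load (\<lambda>i. c *\<^sub>R w i) = c\<^sup>2 * load w"
  by (simp add: load_def power_mult_distrib sum_distrib_left)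

lemma received_scaleR: "received (\<lambda>i. c *\<^sub>R w i) A k = c\<^sup>2 * received w A k"
  by (simp add: received_def power_mult_distrib sum_distrib_left cinner_scaleR norm_mult mult_ac)

text \<open>Scaling shifts every logarithm by the same constant, which cancels in each
  difference.\<close>

lemma scaled_objective_scaleR:
  assumes "c > 0" "load w > 0"
  shows "scaled_objective (\<lambda>i. c *\<^sub>R w i) = scaled_objective w"
proof -
  have "ln (c\<^sup>2 * received w A k + c\<^sup>2 * load w) = ln (c\<^sup>2) + ln (received w A k + load w)" for A k
    using assms received_nonneg[of w A k]
    by (simp add: ln_mult_pos add_nonneg_pos flip: distrib_left)
  then show ?thesis
    by (simp add: scaled_objective_def load_scaleR received_scaleR)
qed

text \<open>Spending the whole budget on one user, along that user's own channel, already gives a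
  positive objective.\<close>

lemma S_optimal_positive:
  assumes "S_optimal g \<beta> \<sigma> P w"
  shows "S_objective g \<beta> \<sigma> w > 0"
proof -
  fix m :: 'k
  define w' where "w' i = (if i = m then (sqrt P / norm (g m)) *\<^sub>R g m else 0)" for i
  have "(\<Sum>i\<in>UNIV. (norm (w' i))\<^sup>2) = (\<Sum>i\<in>UNIV. if i = m then P else 0)"
    using P_pos g_nonzero by (intro sum.cong) (auto simp: w'_def)
  then have "S_feasible P w'"
    by (simp add: S_feasible_def)
  then have "S_objective g \<beta> \<sigma> w' \<le> S_objective g \<beta> \<sigma> w"
    using assms by (auto simp: S_optimal_def is_arg_max_linorder)
  moreover have "0 < S_objective g \<beta> \<sigma> w'"
    unfolding S_objective_eq
  proof (rule sum_pos2[of _ m])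
    have "cinner (w' m) (g m) \<noteq> 0"
      using P_pos g_nonzero[of m] by (simp add: w'_def cinner_scaleR cinner_self)
    then have "snr m * (cmod (cinner (w' m) (g m)))\<^sup>2 > 0"
      using snr_pos by simp
    then show "0 < ln (received w' UNIV m + 1) - ln (received w' (UNIV - {m}) m + 1)"
      using received_nonneg[of w' "UNIV - {m}" m] by (simp add: received_split)
  next
    fix k
    have "snr k * (cmod (cinner (w' k) (g k)))\<^sup>2 \<ge> 0"
      using snr_pos[of k] by simp
    then show "0 \<le> ln (received w' UNIV k + 1) - ln (received w' (UNIV - {k}) k + 1)"
      using received_nonneg[of w' "UNIV - {k}" k] by (simp add: received_split)
  qed auto
  ultimately show ?thesis by simp
qed

text \<open>Rescaling to unit load keeps the scaled objective and makes it the objective of a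
  feasible point.\<close>

lemma scaled_objective_le:
  assumes opt: "S_optimal g \<beta> \<sigma> P w"
  shows "scaled_objective w' \<le> S_objective g \<beta> \<sigma> w"
proof (cases "load w' = 0")
  case True
  then have "w' i = 0" for i
    using P_pos by (simp add: load_def sum_nonneg_eq_0_iff)
  \<comment> \<open>The two logarithms in each term have equal arguments, so the value 0 does not
    depend on the convention for \<open>ln 0\<close>.\<close>
  then have "scaled_objective w' = 0"
    by (simp add: scaled_objective_def received_def)
  then show ?thesis
    using S_optimal_positive[OF opt] by simp
next
  case False
  then have pos: "load w' > 0"
    using load_nonneg[of w'] by simp
  let ?c = "1 / sqrt (load w')"
  let ?v = "\<lambda>i. ?c *\<^sub>R w' i"
  have unit: "load ?v = 1"
    unfolding load_scaleR using pos by (simp add: power_divide)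
  then have "S_objective g \<beta> \<sigma> ?v \<le> S_objective g \<beta> \<sigma> w"
    using opt by (auto simp: S_optimal_def is_arg_max_linorder S_feasible_iff)
  then show ?thesis
    using scaled_objective_unit_load[OF unit] scaled_objective_scaleR[of ?c w'] pos by simp
qed

lemma S_optimal_load:
  assumes opt: "S_optimal g \<beta> \<sigma> P w"
  shows "load w = 1"
proof (rule ccontr)
  assume "load w \<noteq> 1"
  then have lt: "load w < 1"
    using opt by (auto simp: S_optimal_def is_arg_max_linorder S_feasible_iff)
  have "load w \<noteq> 0"
  proof
    assume "load w = 0"
    then have "w i = 0" for i
      using P_pos by (simp add: load_def sum_nonneg_eq_0_iff)
    then show False
      using S_optimal_positive[OF opt] by (simp add: S_objective_eq received_def)
  qed
  then have pos: "load w > 0"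
    using load_nonneg[of w] by simp
  \<comment> \<open>\<open>f s k\<close> is the rate of user \<open>k\<close> at noise level
    \<open>s\<close>: summing \<open>f 1\<close> gives the objective, summing
    \<open>f (load w)\<close> the scaled objective.\<close>
  define f where "f s k = ln (received w UNIV k + s) - ln (received w (UNIV - {k}) k + s)" for s k
  have f_alt: "f s k = ln (1 + snr k * (cmod (cinner (w k) (g k)))\<^sup>2 / (received w (UNIV - {k}) k + s))"
    if "s > 0" for s k
  proof -
    let ?D = "received w (UNIV - {k}) k + s" and ?x = "snr k * (cmod (cinner (w k) (g k)))\<^sup>2"
    have D: "?D > 0"
      using that received_nonneg[of w "UNIV - {k}" k] by simp
    moreover have "?x \<ge> 0"
      using snr_pos[of k] by simp
    ultimately have "ln (?x + ?D) - ln ?D = ln ((?x + ?D) / ?D)"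
      by (intro ln_divide_pos[symmetric]) auto
    moreover have "(?x + ?D) / ?D = 1 + ?x / ?D"
      using D by (simp add: add_divide_distrib)
    ultimately show ?thesis
      by (simp add: f_def received_split add.assoc)
  qed
  have S_f: "S_objective g \<beta> \<sigma> w = sum (f 1) UNIV"
    by (simp add: S_objective_eq f_def)
  then have "\<exists>m. f 1 m \<noteq> 0"
    using S_optimal_positive[OF opt] by (metis less_irrefl sum.neutral)
  then obtain m where "f 1 m \<noteq> 0" by blast
  \<comment> \<open>A user with nonzero rate receives a nonzero signal; there the monotonicity in
    the noise level is strict.\<close>
  then have signal: "snr m * (cmod (cinner (w m) (g m)))\<^sup>2 > 0"
    using snr_pos[of m] f_alt[of 1 m] by (cases "cinner (w m) (g m) = 0") auto
  have arg_pos: "0 < 1 + snr k * (cmod (cinner (w k) (g k)))\<^sup>2 / (received w (UNIV - {k}) k + s)"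
    if "s > 0" for s k
    using that snr_pos[of k] received_nonneg[of w "UNIV - {k}" k]
    by (intro add_pos_nonneg divide_nonneg_nonneg) auto
  have "sum (f 1) UNIV < sum (f (load w)) UNIV"
  proof (rule sum_strict_mono_ex1)
    show "\<forall>k\<in>UNIV. f 1 k \<le> f (load w) k"
    proof
      fix k
      show "f 1 k \<le> f (load w) k"
        unfolding f_alt[OF zero_less_one] f_alt[OF pos]
        using snr_pos[of k] received_nonneg[of w "UNIV - {k}" k] lt pos arg_pos[OF pos] arg_pos[OF zero_less_one]
        by (subst ln_le_cancel_iff) (auto intro!: divide_left_mono mult_pos_pos)
    qed
    show "\<exists>k\<in>UNIV. f 1 k < f (load w) k"
    proof (intro bexI[of _ m])
      show "f 1 m < f (load w) m"
        unfolding f_alt[OF zero_less_one] f_alt[OF pos]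
        using signal received_nonneg[of w "UNIV - {m}" m] lt pos arg_pos[OF pos] arg_pos[OF zero_less_one]
        by (subst ln_less_cancel_iff) (auto intro!: divide_strict_left_mono mult_pos_pos)
    qed simp
  qed simp
  then show False
    using scaled_objective_le[OF opt, of w] by (simp add: S_f scaled_objective_def f_def[abs_def])
qed


text \<open>The optimum maximises the scaled objective without constraint, so the directional
  derivative vanishes along every change of \<open>w m\<close>. The term with \<open>w m\<close>
  comes from differentiating the load.\<close>

lemma S_stationary:
  assumes opt: "S_optimal g \<beta> \<sigma> P w"
  defines "\<nu> \<equiv> \<lambda>k. 1 / (received w (UNIV - {k}) k + 1) - 1 / (received w UNIV k + 1)"
  shows "(snr m / (received w (UNIV - {m}) m + 1)) *\<^sub>R (cinner (g m) (w m) *s g m)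
    = (\<Sum>k\<in>UNIV. (\<nu> k * snr k) *\<^sub>R (cinner (g k) (w m) *s g k)) + (sum \<nu> UNIV / P) *\<^sub>R w m"
    (is "?l = ?r")
proof -
  let ?T = "\<lambda>k. received w UNIV k + 1" and ?D = "\<lambda>k. received w (UNIV - {k}) k + 1"
  have pos: "?T k > 0" "?D k > 0" for k
    using received_nonneg[of w UNIV k] received_nonneg[of w "UNIV - {k}" k] by simp_all
  have load: "load w = 1"
    by (rule S_optimal_load[OF opt])
  \<comment> \<open>The direction is the residual of the claimed equation, so the derivative becomes
    twice the squared norm of \<open>v\<close>.\<close>
  define v where "v = ?l - ?r"
  define p where "p k = snr k *\<^sub>R (cinner (g k) (w m) *s g k)" for k
  \<comment> \<open>\<open>x\<close> and \<open>x2\<close> are the linear and quadratic coefficients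
    in \<open>t\<close> of the power received from stream \<open>m\<close>; \<open>y\<close> and
    \<open>y2\<close> are those of the load.\<close>
  define x where "x k = 2 * inner v (p k)" for k
  define x2 where "x2 k = snr k * (cmod (cinner v (g k)))\<^sup>2" for k
  define y where "y = 2 * inner v (w m) / P"
  define y2 where "y2 = (norm v)\<^sup>2 / P"
  define w' where "w' t = w(m := w m + t *\<^sub>R v)" for t
  have load': "load (w' t) = 1 + t * y + t\<^sup>2 * y2" for t
  proof -
    have "(\<Sum>i\<in>UNIV. (norm (w' t i))\<^sup>2) = (norm (w m + t *\<^sub>R v))\<^sup>2 + (\<Sum>i\<in>UNIV - {m}. (norm (w i))\<^sup>2)"
      by (subst sum.remove[of _ m]) (auto simp: w'_def)
    moreover have "(\<Sum>i\<in>UNIV. (norm (w i))\<^sup>2) = (norm (w m))\<^sup>2 + (\<Sum>i\<in>UNIV - {m}. (norm (w i))\<^sup>2)"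
      by (rule sum.remove) auto
    moreover have "(norm (w m + t *\<^sub>R v))\<^sup>2 = (norm (w m))\<^sup>2 + t * (2 * inner v (w m)) + t\<^sup>2 * (norm v)\<^sup>2"
      unfolding power2_norm_eq_inner
      by (simp add: algebra_simps inner_commute power2_eq_square[of t])
    ultimately have "(\<Sum>i\<in>UNIV. (norm (w' t i))\<^sup>2)
        = (\<Sum>i\<in>UNIV. (norm (w i))\<^sup>2) + t * (2 * inner v (w m)) + t\<^sup>2 * (norm v)\<^sup>2"
      by simp
    then have "load (w' t) = load w + t * y + t\<^sup>2 * y2"
      by (simp add: load_def y_def y2_def add_divide_distrib)
    then show ?thesis
      using load by simp
  qed
  have signal: "snr k * (cmod (cinner (w m + t *\<^sub>R v) (g k)))\<^sup>2
      = snr k * (cmod (cinner (w m) (g k)))\<^sup>2 + t * x k + t\<^sup>2 * x2 k" for t k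
  proof -
    let ?a = "cinner (w m) (g k)" and ?b = "cinner v (g k)"
    have "(cmod (?a + of_real t * ?b))\<^sup>2
        = (cmod ?a)\<^sup>2 + t * (2 * Re (cnj ?a * ?b)) + t\<^sup>2 * (cmod ?b)\<^sup>2"
      unfolding cmod_power2 by (simp add: power2_eq_square algebra_simps)
    moreover have "inner v (p k) = snr k * Re (cnj ?a * ?b)"
      by (simp add: p_def cinner_scale cinner_scaleR cnj_cinner flip: Re_cinner)
    ultimately show ?thesis
      by (simp add: cinner_add cinner_scaleR x_def x2_def algebra_simps)
  qed
  have received': "received (w' t) A k
      = received w A k + (if m \<in> A then t * x k + t\<^sup>2 * x2 k else 0)" for t A k
  proof -
    have "received (w' t) A k
        = (\<Sum>i\<in>A. snr k * (cmod (cinner (w i) (g k)))\<^sup>2 + (if i = m then t * x k + t\<^sup>2 * x2 k else 0))"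
      unfolding received_def by (rule sum.cong) (auto simp: w'_def signal)
    then show ?thesis
      by (simp add: received_def sum.distrib)
  qed
  \<comment> \<open>The interference seen by user \<open>m\<close> excludes stream \<open>m\<close>,
    hence the zero coefficients for \<open>k = m\<close>.\<close>
  define F where "F t = (\<Sum>k\<in>UNIV. ln (?T k + (t * (x k + y) + t\<^sup>2 * (x2 k + y2)))
      - ln (?D k + (t * ((if k = m then 0 else x k) + y) + t\<^sup>2 * ((if k = m then 0 else x2 k) + y2))))" for t
  have F: "F t = scaled_objective (w' t)" for t
    unfolding F_def scaled_objective_def load' received'
    by (rule sum.cong) (auto simp: algebra_simps)
  have "F t \<le> F 0" for t
  proof -
    have "F t \<le> S_objective g \<beta> \<sigma> w"
      unfolding F by (rule scaled_objective_le[OF opt])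
    also have "\<dots> = F 0"
      by (simp add: F_def S_objective_eq)
    finally show ?thesis .
  qed
  moreover have "(F has_real_derivative
      (\<Sum>k\<in>UNIV. (x k + y) / ?T k - ((if k = m then 0 else x k) + y) / ?D k)) (at 0)"
    unfolding F_def using pos
    by (auto intro!: derivative_eq_intros sum.cong)
  ultimately have "(\<Sum>k\<in>UNIV. (x k + y) / ?T k - ((if k = m then 0 else x k) + y) / ?D k) = 0"
    using DERIV_local_max[of F _ 0 1] by simp
  moreover have "(x k + y) / ?T k - ((if k = m then 0 else x k) + y) / ?D k
      = (if k = m then x m / ?D m else 0) - \<nu> k * (x k + y)" for k
    by (simp add: \<nu>_def algebra_simps diff_divide_distrib add_divide_distrib)
  ultimately have "x m / ?D m - (\<Sum>k\<in>UNIV. \<nu> k * (x k + y)) = 0"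
    by (simp add: sum_subtractf)
  moreover have "x m / ?D m - (\<Sum>k\<in>UNIV. \<nu> k * (x k + y)) = 2 * inner v (?l - ?r)"
  proof -
    have l: "?l = (1 / ?D m) *\<^sub>R p m" and r: "?r = (\<Sum>k\<in>UNIV. \<nu> k *\<^sub>R p k) + (sum \<nu> UNIV / P) *\<^sub>R w m"
      by (simp_all add: p_def)
    show ?thesis
      unfolding l r
      by (simp add: inner_diff_right inner_add_right inner_sum_right x_def y_def sum.distrib
          distrib_left sum_distrib_left sum_distrib_right sum_divide_distrib mult_ac)
  qed
  ultimately have "inner v v = 0"
    by (simp add: v_def)
  then show ?thesis
    by (simp add: v_def)
qed

text \<open>Divided by \<open>\<mu>\<close>, the stationarity condition says that the covariance
  matrix with weights \<open>lam\<close> maps \<open>w k\<close> to a multiple of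
  \<open>g k\<close>.\<close>

lemma S_optimal_dual:
  assumes opt: "S_optimal g \<beta> \<sigma> P w"
  obtains lam c where "M_feasible P lam" "M_objective g \<beta> \<sigma> lam = S_objective g \<beta> \<sigma> w"
    "\<And>k. cmod (c k) = 1 \<and> w k = c k *s precoder g \<beta> \<sigma> P lam k"
proof -
  define T where "T k = received w UNIV k + 1" for k
  define D where "D k = received w (UNIV - {k}) k + 1" for k
  define s where "s k = cinner (g k) (w k)" for k
  define \<nu> where "\<nu> k = 1 / D k - 1 / T k" for k
  \<comment> \<open>This is the coefficient of \<open>w m\<close> in \<open>S_stationary\<close>;
    dividing by it makes the weights \<open>lam\<close> sum to \<open>P\<close>.\<close>
  define \<mu> where "\<mu> = sum \<nu> UNIV / P"
  define lam where "lam k = \<nu> k / \<mu>" for k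
  define z where "z k = of_real (snr k / (\<mu> * D k)) * s k" for k
  have D_pos: "D k > 0" for k
    using received_nonneg[of w "UNIV - {k}" k] by (simp add: D_def)
  have T_eq: "T k = D k + snr k * (cmod (s k))\<^sup>2" for k
    by (simp add: T_def D_def s_def received_split cmod_cinner_commute[of "w k"])
  have T_pos: "T k > 0" for k
    using D_pos[of k] snr_pos[of k] by (simp add: T_eq add_pos_nonneg)
  have \<nu>_eq: "\<nu> k = snr k * (cmod (s k))\<^sup>2 / (D k * T k)" for k
    using D_pos[of k] T_pos[of k] T_eq[of k] by (simp add: \<nu>_def diff_frac_eq)
  have \<nu>_nonneg: "\<nu> k \<ge> 0" for k
    using D_pos[of k] T_pos[of k] snr_pos[of k] by (simp add: \<nu>_eq)
  have total: "sum \<nu> UNIV \<noteq> 0"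
  proof
    assume "sum \<nu> UNIV = 0"
    then have "\<nu> k = 0" for k
      using \<nu>_nonneg by (simp add: sum_nonneg_eq_0_iff)
    then have "T k = D k" for k
      using D_pos[of k] T_pos[of k] by (simp add: \<nu>_def field_simps)
    then have "S_objective g \<beta> \<sigma> w = 0"
      by (simp add: S_objective_eq flip: T_def D_def)
    then show False
      using S_optimal_positive[OF opt] by simp
  qed
  then have \<mu>_pos: "\<mu> > 0"
    using P_pos \<nu>_nonneg by (simp add: \<mu>_def less_le sum_nonneg)
  have feas: "M_feasible P lam"
    using \<mu>_pos \<nu>_nonneg P_pos total
    by (simp add: M_feasible_def lam_def flip: sum_divide_distrib) (simp add: \<mu>_def)
  then have nonneg: "\<forall>k. lam k \<ge> 0"
    by (simp add: M_feasible_def)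
  have w_eq: "w m = z m *s mmse lam m" for m
  proof -
    have "cov UNIV lam *v w m = (1 / \<mu>) *\<^sub>R \<mu> *\<^sub>R (cov UNIV lam *v w m)"
      using \<mu>_pos by simp
    also have "\<mu> *\<^sub>R (cov UNIV lam *v w m) = (snr m / D m) *\<^sub>R (s m *s g m)"
      using S_stationary[OF opt, of m] \<mu>_pos
      by (simp add: cov_vector_mult scaleR_add_right scaleR_sum_right lam_def s_def
          flip: T_def D_def \<nu>_def \<mu>_def)
    also have "(1 / \<mu>) *\<^sub>R (snr m / D m) *\<^sub>R (s m *s g m) = z m *s g m"
      by (simp add: z_def vec_eq_iff scaleR_conv_of_real[where 'a = complex])
    also have "\<dots> = cov UNIV lam *v (z m *s mmse lam m)"
      by (simp add: vector_scalar_commute cov_mmse[OF nonneg])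
    finally have "cov UNIV lam *v (w m - z m *s mmse lam m) = 0"
      by (simp add: matrix_vector_mult_diff_distrib)
    then show ?thesis
      using cov_definite[OF nonneg, of "w m - z m *s mmse lam m" UNIV] by simp
  qed
  \<comment> \<open>Pairing \<open>w k = z k *s mmse lam k\<close> with \<open>g k\<close> and
    cancelling \<open>s k\<close> determines the gain as \<open>\<mu> * D k / snr k\<close>.\<close>
  have boost_eq: "boost lam k = T k / D k" for k
  proof (cases "s k = 0")
    case True
    then show ?thesis
      using D_pos[of k] by (simp add: boost_def lam_def \<nu>_eq T_eq)
  next
    case False
    have "s k = z k * of_real (gain lam k)"
      unfolding s_def by (subst w_eq) (simp add: cinner_scale cinner_mmse[OF nonneg])
    also have "\<dots> = s k * of_real (snr k / (\<mu> * D k) * gain lam k)"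
      by (simp add: z_def)
    finally have "complex_of_real (snr k / (\<mu> * D k) * gain lam k) = of_real 1"
      using False by (metis mult_cancel_left mult_1_right of_real_1)
    then have "snr k / (\<mu> * D k) * gain lam k = 1"
      by (simp only: of_real_eq_iff)
    then have "snr k * gain lam k = \<mu> * D k"
      using \<mu>_pos D_pos[of k] by (simp add: field_simps)
    then have "lam k * snr k * gain lam k = \<nu> k * D k"
      using \<mu>_pos by (simp add: lam_def mult.assoc)
    also have "\<dots> = 1 - D k / T k"
      using D_pos[of k] by (simp add: \<nu>_def left_diff_distrib)
    finally show ?thesis
      by (simp add: boost_def)
  qed
  have coeff: "lam k * snr k * boost lam k = \<mu> * (cmod (z k))\<^sup>2" for k
    using \<mu>_pos D_pos[of k] T_pos[of k] snr_pos[of k]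
    by (simp add: boost_eq lam_def \<nu>_eq z_def norm_mult norm_divide power_mult_distrib
        power_divide power2_eq_square mult_ac)
  \<comment> \<open>The weighted norms in \<open>mu_opt\<close> are \<open>\<mu>\<close> times the
    powers of \<open>w\<close>, and \<open>w\<close> uses the full budget.\<close>
  have mu: "mu_opt g \<beta> \<sigma> P lam = \<mu>"
  proof -
    have "boost lam k * (lam k * snr k * (norm (mmse lam k))\<^sup>2) = \<mu> * (norm (w k))\<^sup>2" for k
    proof -
      have "norm (w k) = cmod (z k) * norm (mmse lam k)"
        unfolding w_eq norm_vec_def L2_set_def
        by (simp add: norm_mult power_mult_distrib real_sqrt_mult flip: sum_distrib_left)
      then show ?thesis
        using coeff[of k] by (simp add: power_mult_distrib mult_ac)
    qed
    then have "mu_opt g \<beta> \<sigma> P lam = \<mu> * load w"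
      by (simp add: mu_opt_eq load_def sum_distrib_left sum_divide_distrib)
    then show ?thesis
      by (simp add: S_optimal_load[OF opt])
  qed
  \<comment> \<open>The phase of \<open>z k\<close>; the value 1 at zero only keeps it unimodular,
    since \<open>w k\<close> and the precoder both vanish there.\<close>
  define c where "c k = (if z k = 0 then 1 else z k / cmod (z k))" for k
  have "cmod (c k) = 1 \<and> w k = c k *s precoder g \<beta> \<sigma> P lam k" for k
  proof -
    have "precoder g \<beta> \<sigma> P lam k = cmod (z k) *\<^sub>R mmse lam k"
      using \<mu>_pos by (simp add: precoder_eq[OF feas] mu coeff)
    then show ?thesis
      by (auto simp: w_eq[of k] c_def norm_divide vec_eq_iff scaleR_conv_of_real[where 'a = complex])
  qed
  moreover have "M_objective g \<beta> \<sigma> lam = S_objective g \<beta> \<sigma> w"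
    unfolding M_objective_def S_objective_eq M_rate_boost[OF nonneg] boost_eq
    using D_pos T_pos by (simp add: ln_divide_pos flip: T_def D_def)
  ultimately show thesis
    using feas by (intro that)
qed

section \<open>Existence and comparison of optima\<close>

text \<open>The weights are read as vectors in \<open>real^'k\<close>, where the feasible simplex is
  compact. The objective is continuous on it because the determinants are positive.\<close>

lemma M_optimal_exists: "\<exists>lam. M_optimal g \<beta> \<sigma> P lam"
proof -
  let ?C = "{x :: real^'k. M_feasible P (\<lambda>k. x $ k)}"
  let ?f = "\<lambda>x :: real^'k. M_objective g \<beta> \<sigma> (\<lambda>k. x $ k)"
  have eq: "?C = {x. (\<Sum>k\<in>UNIV. x $ k) = P} \<inter> (\<Inter>k. {x. 0 \<le> x $ k})"
    by (auto simp: M_feasible_def)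
  have "closed ?C"
    unfolding eq by (intro closed_Int closed_INT ballI closed_Collect_eq closed_Collect_le continuous_intros)
  moreover have "bounded ?C"
  proof (rule boundedI)
    fix x assume x: "x \<in> ?C"
    have "norm x \<le> (\<Sum>k\<in>UNIV. \<bar>x $ k\<bar>)"
      by (rule norm_le_l1_cart)
    also have "\<dots> = P"
      using x by (simp add: M_feasible_def)
    finally show "norm x \<le> P" .
  qed
  ultimately have "compact ?C"
    by (simp add: compact_eq_bounded_closed)
  moreover have "(\<chi> k. P / CARD('k)) \<in> ?C"
    using P_pos by (simp add: M_feasible_def)
  then have "?C \<noteq> {}" by blast
  moreover have "continuous_on ?C ?f"
  proof -
    have "\<sigma> i \<noteq> 0" for i
      using \<sigma>_pos[of i] by auto
    then have "continuous_on ?C (\<lambda>x. cov A (\<lambda>k. x $ k))" for A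
      unfolding cov_matrix_def by (intro continuous_intros) simp_all
    then have "continuous_on ?C (\<lambda>x. Re (det (cov A (\<lambda>k. x $ k))))" for A
      by (intro continuous_intros continuous_on_det)
    moreover have "Re (det (cov A (\<lambda>k. x $ k))) \<noteq> 0" if "x \<in> ?C" for x A
      using det_cov_pos[of "\<lambda>k. x $ k" A] that by (auto simp: M_feasible_def)
    ultimately show ?thesis
      unfolding M_objective_def M_rate_def
      by (intro continuous_on_sum continuous_on_diff continuous_on_ln) auto
  qed
  ultimately obtain x where x: "x \<in> ?C" "\<And>y. y \<in> ?C \<Longrightarrow> ?f y \<le> ?f x"
    using continuous_attains_sup[of ?C ?f] by blast
  have "M_optimal g \<beta> \<sigma> P (\<lambda>k. x $ k)"
    unfolding M_optimal_def is_arg_max_linorder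
  proof (intro conjI allI impI)
    fix l :: "'k \<Rightarrow> real" assume "M_feasible P l"
    then show "M_objective g \<beta> \<sigma> l \<le> ?f x"
      using x(2)[of "\<chi> k. l k"] by (simp add: vec_lambda_inverse)
  qed (use x(1) in simp)
  then show ?thesis by blast
qed

text \<open>In the product space \<open>complex^'n^'k\<close> the feasible set is the closed ball of
  radius \<open>sqrt P\<close>.\<close>

lemma S_optimal_exists: "\<exists>w. S_optimal g \<beta> \<sigma> P w"
proof -
  let ?f = "\<lambda>x :: complex^'n^'k. S_objective g \<beta> \<sigma> (\<lambda>k. x $ k)"
  have ball: "x \<in> cball 0 (sqrt P) \<longleftrightarrow> S_feasible P (\<lambda>k. x $ k)" for x :: "complex^'n^'k"
    by (simp add: S_feasible_def norm_vec_def[of x] L2_set_def)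
  have "continuous_on (cball 0 (sqrt P)) ?f"
  proof -
    have "continuous_on (cball 0 (sqrt P)) (\<lambda>x :: complex^'n^'k. received (\<lambda>k. x $ k) A k)" for A k
      unfolding received_def cinner_def by (intro continuous_intros)
    moreover have "received w A k + 1 \<noteq> 0" for w A k
      using received_nonneg[of w A k] by linarith
    ultimately show ?thesis
      unfolding S_objective_eq by (intro continuous_intros) auto
  qed
  moreover have "cball (0 :: complex^'n^'k) (sqrt P) \<noteq> {}"
    using P_pos by simp
  ultimately obtain x where x: "x \<in> cball 0 (sqrt P)" "\<And>y. y \<in> cball 0 (sqrt P) \<Longrightarrow> ?f y \<le> ?f x"
    using continuous_attains_sup[OF compact_cball, of "0 :: complex^'n^'k" "sqrt P" ?f] by blast
  have "S_optimal g \<beta> \<sigma> P (\<lambda>k. x $ k)"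
    unfolding S_optimal_def is_arg_max_linorder
  proof (intro conjI allI impI)
    fix w :: "'k \<Rightarrow> complex^'n" assume "S_feasible P w"
    then show "S_objective g \<beta> \<sigma> w \<le> ?f x"
      using x(2)[of "\<chi> k. w k", unfolded ball] by (simp add: vec_lambda_inverse)
  qed (use x(1) ball in blast)
  then show ?thesis by blast
qed

section \<open>Equality of the optimal values\<close>

lemma M_optimal_imp_S_optimal:
  assumes opt: "M_optimal g \<beta> \<sigma> P lam"
  shows "S_optimal g \<beta> \<sigma> P (precoder g \<beta> \<sigma> P lam)"
proof -
  obtain w where w: "S_optimal g \<beta> \<sigma> P w"
    using S_optimal_exists by blast
  obtain l where "M_feasible P l" "M_objective g \<beta> \<sigma> l = S_objective g \<beta> \<sigma> w"
    using S_optimal_dual[OF w] by blast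
  \<comment> \<open>The dual point \<open>l\<close> attains the value of \<open>w\<close>, and
    \<open>lam\<close> attains at least as much; the precoder of \<open>lam\<close> inherits that
    value.\<close>
  then have le: "S_objective g \<beta> \<sigma> w \<le> S_objective g \<beta> \<sigma> (precoder g \<beta> \<sigma> P lam)"
    using opt unfolding S_objective_precoder[OF opt] by (auto simp: M_optimal_def is_arg_max_linorder)
  have "S_objective g \<beta> \<sigma> y \<le> S_objective g \<beta> \<sigma> w" if "S_feasible P y" for y
    using w that by (simp add: S_optimal_def is_arg_max_linorder)
  then have "S_objective g \<beta> \<sigma> y \<le> S_objective g \<beta> \<sigma> (precoder g \<beta> \<sigma> P lam)"
    if "S_feasible P y" for y
    using le that by (meson order_trans)
  moreover have "S_feasible P (precoder g \<beta> \<sigma> P lam)"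
    using opt precoder_feasible by (simp add: M_optimal_def is_arg_max_linorder)
  ultimately show ?thesis
    by (simp add: S_optimal_def is_arg_max_linorder)
qed

lemma S_optimal_imp_precoder:
  assumes opt: "S_optimal g \<beta> \<sigma> P w"
  shows "\<exists>lam c. M_optimal g \<beta> \<sigma> P lam \<and>
    (\<forall>k. cmod (c k) = 1 \<and> w k = c k *s precoder g \<beta> \<sigma> P lam k)"
proof -
  obtain lam c where lam: "M_feasible P lam" "M_objective g \<beta> \<sigma> lam = S_objective g \<beta> \<sigma> w"
    and c: "\<And>k. cmod (c k) = 1 \<and> w k = c k *s precoder g \<beta> \<sigma> P lam k"
    using S_optimal_dual[OF opt] by blast
  obtain l where l: "M_optimal g \<beta> \<sigma> P l"
    using M_optimal_exists by blast
  then have feas: "M_feasible P l"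
    and max: "\<And>y. M_feasible P y \<Longrightarrow> M_objective g \<beta> \<sigma> y \<le> M_objective g \<beta> \<sigma> l"
    by (simp_all add: M_optimal_def is_arg_max_linorder)
  \<comment> \<open>The precoder of the optimal \<open>l\<close> is feasible and has the value of
    \<open>l\<close>, so it cannot beat \<open>w\<close>, whose value \<open>lam\<close>
    attains.\<close>
  have "M_objective g \<beta> \<sigma> l \<le> M_objective g \<beta> \<sigma> lam"
    unfolding lam(2) S_objective_precoder[OF l, symmetric]
    using opt precoder_feasible[OF feas] by (simp add: S_optimal_def is_arg_max_linorder)
  then have "M_objective g \<beta> \<sigma> y \<le> M_objective g \<beta> \<sigma> lam" if "M_feasible P y" for y
    using max[OF that] by simp
  then have "M_optimal g \<beta> \<sigma> P lam"
    using lam(1) by (simp add: M_optimal_def is_arg_max_linorder)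
  with c show ?thesis by blast
qed

end

section \<open>Array responses as channel vectors\<close>

lemma array_response_nonzero: "array_response d lc x $ i \<noteq> 0"
  by (simp add: array_response_def)

lemma upa_response_nonzero: "upa_response dx dy lc tx ty \<noteq> 0"
proof -
  have "upa_response dx dy lc tx ty $ p \<noteq> 0" for p
    by (simp add: upa_response_def kron_def array_response_nonzero)
  then show ?thesis by (metis zero_index)
qed

theorem theorem3:
  fixes g :: "'k::finite \<Rightarrow> complex^('mx::{finite,linorder} \<times> 'my::{finite,linorder})"
    and \<theta>x \<theta>y \<beta> \<sigma> :: "'k \<Rightarrow> real"
    and dx dy lc P :: real
  assumes "dx > 0" and "dy > 0" and "lc > 0" and "P > 0"
    and "\<And>k. \<beta> k > 0" and "\<And>k. (\<sigma> k)\<^sup>2 > 0"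
    and "\<And>k. g k = upa_response dx dy lc (\<theta>x k) (\<theta>y k)"
  shows "(\<forall>lam. M_optimal g \<beta> \<sigma> P lam \<longrightarrow> S_optimal g \<beta> \<sigma> P (precoder g \<beta> \<sigma> P lam))
    \<and> (\<forall>w. S_optimal g \<beta> \<sigma> P w \<longrightarrow>
          (\<exists>lam c. M_optimal g \<beta> \<sigma> P lam \<and>
             (\<forall>k. cmod (c k) = 1 \<and> w k = c k *s precoder g \<beta> \<sigma> P lam k)))"
proof -
  interpret dual_channels g \<beta> \<sigma> P
    using assms by unfold_locales (simp_all add: upa_response_nonzero)
  show ?thesis
    using M_optimal_imp_S_optimal S_optimal_imp_precoder by blast
qed

end
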